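(* The set of S-ideals of a ring, ordered by inclusion, need not in general form a modular lattice. Specifically, for the ring $R = \mathbb{Z}_3 \times \mathbb{Z}_{12} \times \mathbb{Z}_7$, the set of all S-ideals of $R$ (with $\{0\}$ and $R$ counted as S-ideals), partially ordered by inclusion, is a lattice that is not modular.
   Context: $\mathbb{Z}_n$ is the ring of integers modulo $n$, and $R$ has componentwise operations. An S-ideal (Smarandache ideal) of a ring $R$ is a (two-sided) ideal $A$ of $R$ such that some proper subset of $A$ is a field with respect to the operations induced from $R$. The multiplicative identity of that field is not required to be the identity of $R$; a field has at least two elements. By convention $\{0\}$ and $R$ are also counted as S-ideals; they are the least and greatest elements of the lattice. A lattice $L$ is modular if $x \le z$ implies $x \vee (y \wedge z) = (x \vee y) \wedge z$ for all $x,y,z\in L$. *)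

theory Defs
  imports "HOL-Number_Theory.Residues" "HOL-Algebra.Chinese_Remainder"
begin

text \<open>
  The multiplicative identity \<open>e\<close> of the field \<open>F\<close> is existentially quantified: it is in
  general only an idempotent of \<open>R\<close>. The additive identity of \<open>F\<close> is necessarily that of \<open>R\<close>,
  because \<open>F\<close> is an additive subgroup of \<open>R\<close>.
\<close>

definition is_field_in :: "'a set \<Rightarrow> ('a, 'b) ring_scheme \<Rightarrow> bool"
  where "is_field_in F R \<longleftrightarrow> (\<exists>e\<in>F. field (R\<lparr>carrier := F, one := e\<rparr>))"

definition Smarandache_ideal :: "'a set \<Rightarrow> ('a, 'b) ring_scheme \<Rightarrow> bool"
  where "Smarandache_ideal A R \<longleftrightarrow> ideal A R \<and> (\<exists>F. F \<subset> A \<and> is_field_in F R)"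

text \<open>The zero ideal and the whole ring are S-ideals by convention.\<close>

definition S_ideal :: "'a set \<Rightarrow> ('a, 'b) ring_scheme \<Rightarrow> bool"
  where "S_ideal A R \<longleftrightarrow> Smarandache_ideal A R \<or> A = {\<zero>\<^bsub>R\<^esub>} \<or> A = carrier R"

definition S_ideal_poset :: "('a, 'b) ring_scheme \<Rightarrow> 'a set gorder"
  where "S_ideal_poset R = \<lparr>carrier = {A. S_ideal A R}, eq = (=), le = (\<subseteq>)\<rparr>"

locale modular_lattice = lattice +
  assumes modular_law:
    "\<lbrakk>x \<in> carrier L; y \<in> carrier L; z \<in> carrier L; x \<sqsubseteq> z\<rbrakk>
      \<Longrightarrow> x \<squnion> (y \<sqinter> z) = (x \<squnion> y) \<sqinter> z"

definition Z3_Z12_Z7 :: "(int \<times> int \<times> int) ring"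
  where "Z3_Z12_Z7 = RDirProd (residue_ring 3) (RDirProd (residue_ring 12) (residue_ring 7))"

end

(*
  Among the nonzero ideals the S-ideals are closed upwards, so in any ring two S-ideals have their
  sum as join, and as meet their intersection if that is an S-ideal and the zero ideal otherwise.

  In Z3 x Z12 x Z7 take x = <(1,6,0)>, z = <(1,3,0)> and y = <(0,1,0)>. Then x is properly contained
  in z, and z in the join of x and y. The intersection of y and z is 0 x 3 Z12 x 0, a copy of Z4,
  which contains no field: its only nonzero idempotent is (0,9,0), and (0,9,0) + (0,9,0) squares to
  zero. Hence y and z meet in the zero ideal, and 0, x, z, y and the join of x and y form a pentagon.
*)

theory Submission
  imports Defs
begin

lemma S_ideal_imp_ideal:
  assumes "ring R" "S_ideal A R"
  shows "ideal A R"
  using assms ring.zeroideal ring.oneideal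
  unfolding S_ideal_def Smarandache_ideal_def by blast

lemma Smarandache_ideal_mono:
  assumes "Smarandache_ideal A R" "ideal B R" "A \<subseteq> B"
  shows "Smarandache_ideal B R"
  using assms unfolding Smarandache_ideal_def by blast

text \<open>A field properly inside \<open>A\<close> stays properly inside \<open>B\<close>, and
  \<open>A = carrier R\<close> forces \<open>B = carrier R\<close>. The zero ideal is excluded
  because it lies in every ideal, S-ideal or not.\<close>

lemma S_ideal_mono:
  assumes "S_ideal A R" "A \<noteq> {\<zero>\<^bsub>R\<^esub>}" "ideal B R" "A \<subseteq> B"
  shows "S_ideal B R"
proof -
  have "B \<subseteq> carrier R"
    using assms(3) by (auto intro: ideal.Icarr)
  then show ?thesis
    using assms Smarandache_ideal_mono unfolding S_ideal_def by blast
qed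

lemma S_ideal_poset_partial_order: "partial_order (S_ideal_poset R)"
  by unfold_locales (auto simp: S_ideal_poset_def)

lemma S_ideal_poset_join:
  assumes R: "ring R" and A: "S_ideal A R" and B: "S_ideal B R"
  shows "\<exists>S. least (S_ideal_poset R) S (Upper (S_ideal_poset R) {A, B})"
proof -
  interpret ring R by fact
  define S where "S = Idl\<^bsub>R\<^esub> (A \<union> B)"
  have idA: "ideal A R" and idB: "ideal B R"
    using A B R by (auto intro: S_ideal_imp_ideal)
  then have AB: "A \<union> B \<subseteq> carrier R"
    by (auto intro: ideal.Icarr)
  then have idS: "ideal S R" and sub: "A \<union> B \<subseteq> S"
    unfolding S_def by (rule genideal_ideal, rule genideal_self)
  have least: "S \<subseteq> C" if "ideal C R" "A \<union> B \<subseteq> C" for C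
    unfolding S_def using that by (rule genideal_minimal)
  have "S_ideal S R"
  \<comment> \<open>\<open>S_ideal_mono\<close> needs a nonzero S-ideal below \<open>S\<close>; if
    neither \<open>A\<close> nor \<open>B\<close> is one, \<open>S\<close> itself is zero.\<close>
  proof (cases "A \<union> B \<subseteq> {\<zero>\<^bsub>R\<^esub>}")
    case True
    then have "S = {\<zero>\<^bsub>R\<^esub>}"
      using least[OF zeroideal] idS by (auto dest: additive_subgroup.zero_closed ideal.axioms(1))
    then show ?thesis by (simp add: S_ideal_def)
  next
    case False
    then show ?thesis
      using S_ideal_mono[OF A _ idS] S_ideal_mono[OF B _ idS] sub by blast
  qed
  then have "least (S_ideal_poset R) S (Upper (S_ideal_poset R) {A, B})"
    using sub least A B S_ideal_imp_ideal[OF R]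
    by (auto simp: least_def Upper_def S_ideal_poset_def)
  then show ?thesis by blast
qed

lemma S_ideal_poset_meet:
  assumes R: "ring R" and A: "S_ideal A R" and B: "S_ideal B R"
  shows "\<exists>S. greatest (S_ideal_poset R) S (Lower (S_ideal_poset R) {A, B})"
proof -
  interpret ring R by fact
  define S where "S = (if S_ideal (A \<inter> B) R then A \<inter> B else {\<zero>\<^bsub>R\<^esub>})"
  have idA: "ideal A R" and idB: "ideal B R"
    using A B R by (auto intro: S_ideal_imp_ideal)
  then have idAB: "ideal (A \<inter> B) R"
    by (rule i_intersect)
  have "S_ideal S R"
    by (simp add: S_def S_ideal_def)
  moreover have "S \<subseteq> A \<inter> B"
    using idAB by (auto simp: S_def dest: additive_subgroup.zero_closed ideal.axioms(1))
  \<comment> \<open>A nonzero \<open>C\<close> would make \<open>A \<inter> B\<close> an S-ideal by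
    upward closure, so in the second case of \<open>S\<close> only the zero ideal remains.\<close>
  moreover have "C \<subseteq> S" if "S_ideal C R" "C \<subseteq> A \<inter> B" for C
    using that S_ideal_mono[OF that(1) _ idAB that(2)] by (auto simp: S_def)
  ultimately have "greatest (S_ideal_poset R) S (Lower (S_ideal_poset R) {A, B})"
    using A B by (auto simp: greatest_def Lower_def S_ideal_poset_def)
  then show ?thesis by blast
qed

lemma S_ideal_poset_lattice:
  assumes "ring R"
  shows "lattice (S_ideal_poset R)"
proof -
  interpret partial_order "S_ideal_poset R"
    by (rule S_ideal_poset_partial_order)
  show ?thesis
    using S_ideal_poset_join[OF assms] S_ideal_poset_meet[OF assms]
    by unfold_locales (auto simp: S_ideal_poset_def)
qed

text \<open>The multiples of an idempotent of additive order 3 form a copy of Z3.\<close>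

lemma is_field_in_order_3:
  fixes R (structure)
  assumes R: "ring R" and e: "e \<in> carrier R" "e \<otimes> e = e" "e \<oplus> (e \<oplus> e) = \<zero>" "e \<noteq> \<zero>"
  shows "is_field_in {\<zero>, e, e \<oplus> e} R"
proof -
  interpret ring R by fact
  let ?F = "{\<zero>, e, e \<oplus> e}"
  let ?R = "R\<lparr>carrier := ?F, one := e\<rparr>"
  have add: "(e \<oplus> e) \<oplus> e = \<zero>" "(e \<oplus> e) \<oplus> (e \<oplus> e) = e"
    using e by (simp_all add: a_assoc)
  have mult: "e \<otimes> (e \<oplus> e) = e \<oplus> e" "(e \<oplus> e) \<otimes> e = e \<oplus> e" "(e \<oplus> e) \<otimes> (e \<oplus> e) = e"
    using e add by (simp_all add: l_distr r_distr)
  have sub: "?F \<subseteq> carrier R"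
    using e by auto
  have "cring ?R"
  proof (rule cringI)
    show "abelian_group ?R"
    proof (rule abelian_groupI)
      show "\<exists>y\<in>carrier ?R. y \<oplus>\<^bsub>?R\<^esub> x = \<zero>\<^bsub>?R\<^esub>" if "x \<in> carrier ?R" for x
        using that e add by auto
    qed (use sub e add in \<open>auto simp: a_assoc a_comm\<close>)
    show "comm_monoid ?R"
      by (rule comm_monoidI) (use sub e mult in \<open>auto simp: m_assoc\<close>)
  qed (use sub in \<open>auto intro: l_distr\<close>)
  \<comment> \<open>Each of the two nonzero elements is its own inverse.\<close>
  then have "field ?R"
    by (rule cring.cring_fieldI2) (use e mult in auto)
  then show ?thesis
    unfolding is_field_in_def by blast
qed

text \<open>\<open>e\<close> is the identity of the field. The implication holds because a field has
  no zero divisors; it is the test that an idempotent such as \<open>(0, 9, 0)\<close>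
  fails.\<close>

lemma is_field_in_obtain_idempotent:
  assumes "is_field_in F R"
  obtains e where "e \<in> F" "e \<otimes>\<^bsub>R\<^esub> e = e" "e \<noteq> \<zero>\<^bsub>R\<^esub>"
    "(e \<oplus>\<^bsub>R\<^esub> e) \<otimes>\<^bsub>R\<^esub> (e \<oplus>\<^bsub>R\<^esub> e) = \<zero>\<^bsub>R\<^esub> \<Longrightarrow> e \<oplus>\<^bsub>R\<^esub> e = \<zero>\<^bsub>R\<^esub>"
proof -
  obtain e where e: "e \<in> F" and "field (R\<lparr>carrier := F, one := e\<rparr>)"
    using assms unfolding is_field_in_def by blast
  then interpret F: field "R\<lparr>carrier := F, one := e\<rparr>" by simp
  show thesis
  proof (rule that[OF e])
    show "e \<otimes>\<^bsub>R\<^esub> e = e" using F.l_one[of e] e by simp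
    show "e \<noteq> \<zero>\<^bsub>R\<^esub>" using F.one_not_zero by simp
    show "e \<oplus>\<^bsub>R\<^esub> e = \<zero>\<^bsub>R\<^esub>"
      if "(e \<oplus>\<^bsub>R\<^esub> e) \<otimes>\<^bsub>R\<^esub> (e \<oplus>\<^bsub>R\<^esub> e) = \<zero>\<^bsub>R\<^esub>"
      using F.integral[of "e \<oplus>\<^bsub>R\<^esub> e" "e \<oplus>\<^bsub>R\<^esub> e"] F.a_closed[of e e] that e by simp
  qed
qed

text \<open>The element \<open>a\<close> witnesses that the field
  \<open>{\<zero>, e, e \<oplus> e}\<close> is a proper subset of \<open>A\<close>.\<close>

lemma Smarandache_ideal_order_3I:
  fixes R (structure)
  assumes A: "ideal A R" and e: "e \<in> A" "e \<otimes> e = e" "e \<oplus> (e \<oplus> e) = \<zero>" "e \<noteq> \<zero>"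
    and a: "a \<in> A" "a \<noteq> \<zero>" "a \<noteq> e" "a \<noteq> e \<oplus> e"
  shows "Smarandache_ideal A R"
proof -
  interpret ideal A R by fact
  have "{\<zero>, e, e \<oplus> e} \<subset> A"
    using e a by auto
  moreover have "is_field_in {\<zero>, e, e \<oplus> e} R"
    using is_field_in_order_3[OF ring_axioms] e Icarr by blast
  ultimately show ?thesis
    using A unfolding Smarandache_ideal_def by blast
qed

lemma Z3_Z12_Z7_simps:
  "carrier Z3_Z12_Z7 = {0..2} \<times> {0..11} \<times> {0..6}"
  "\<zero>\<^bsub>Z3_Z12_Z7\<^esub> = (0, 0, 0)"
  "(a, b, c) \<oplus>\<^bsub>Z3_Z12_Z7\<^esub> (a', b', c') = ((a + a') mod 3, (b + b') mod 12, (c + c') mod 7)"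
  "(a, b, c) \<otimes>\<^bsub>Z3_Z12_Z7\<^esub> (a', b', c') = (a * a' mod 3, b * b' mod 12, c * c' mod 7)"
  by (simp_all add: Z3_Z12_Z7_def RDirProd_def DirProd_def monoid.defs residue_ring_def)

text \<open>By commutativity the one-sided multiples that make up \<open>PIdl\<close> form a
  two-sided ideal.\<close>

lemma cring_Z3_Z12_Z7: "cring Z3_Z12_Z7"
proof -
  have cring: "cring (residue_ring m)" if "m > 1" for m
    using that by (intro residues.cring residues.intro)
  have "ring Z3_Z12_Z7"
    unfolding Z3_Z12_Z7_def
    by (intro RDirProd_ring cring.axioms(1) cring) simp_all
  then interpret ring Z3_Z12_Z7 .
  show ?thesis
    by unfold_locales (auto simp: Z3_Z12_Z7_simps mult.commute)
qed

theorem mainTheorem1: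
  shows "ring Z3_Z12_Z7
    \<and> lattice (S_ideal_poset Z3_Z12_Z7)
    \<and> \<not> modular_lattice (S_ideal_poset Z3_Z12_Z7)"
proof (intro conjI notI)
  let ?R = "Z3_Z12_Z7"
  let ?L = "S_ideal_poset ?R"
  interpret cring ?R by (rule cring_Z3_Z12_Z7)
  show "ring ?R" ..
  then show "lattice ?L" by (rule S_ideal_poset_lattice)
  assume "modular_lattice ?L"
  then interpret L: modular_lattice ?L .

  \<comment> \<open>As products: \<open>x\<close> is Z3 x 6 Z12 x 0, \<open>y\<close> is 0 x Z12 x
    0, and \<open>z\<close> is Z3 x 3 Z12 x 0.\<close>
  define x where "x = PIdl\<^bsub>?R\<^esub> (1, 6, 0)"
  define y where "y = PIdl\<^bsub>?R\<^esub> (0, 1, 0)"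
  define z where "z = PIdl\<^bsub>?R\<^esub> (1, 3, 0)"
  note PIdl = cgenideal_def Z3_Z12_Z7_simps
  have ideals: "ideal x ?R" "ideal y ?R" "ideal z ?R"
    unfolding x_def y_def z_def by (intro cgenideal_ideal; simp add: Z3_Z12_Z7_simps)+
  have gen: "(1, 6, 0) \<in> x" "(0, 1, 0) \<in> y" "(1, 3, 0) \<in> z"
    unfolding x_def y_def z_def by (intro cgenideal_self; simp add: Z3_Z12_Z7_simps)+

  have mult: "(a * b mod 3, c * d mod 12, 0) \<in> I"
    if "ideal I ?R" "(b, d, 0) \<in> I" "a \<in> {0..2}" "c \<in> {0..11}" for I a b c d
    using ideal.I_l_closed[OF that(1,2), of "(a, c, 0)"] that(3,4) by (simp add: Z3_Z12_Z7_simps)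
  have "(1, 6, 0) \<in> z"
    using mult[OF ideals(3) gen(3), of 1 2] by simp
  then have xz: "x \<subseteq> z"
    unfolding x_def using ideals(3) by (rule cgenideal_minimal[rotated])
  \<comment> \<open>The field in \<open>x\<close> is Z3 x 0 x 0, with identity
    \<open>(1, 0, 0)\<close>.\<close>
  have "(1, 0, 0) \<in> x"
    using mult[OF ideals(1) gen(1), of 1 0] by simp
  with ideals(1) have Sx: "Smarandache_ideal x ?R"
    by (rule Smarandache_ideal_order_3I[where a = "(1, 6, 0)"])
       (use gen(1) in \<open>simp_all add: Z3_Z12_Z7_simps\<close>)
  \<comment> \<open>In Z12, 4 is the idempotent congruent to 1 mod 3 and 0 mod 4; its multiples 0,
    4, 8 form a field.\<close>
  have "(0, 4, 0) \<in> y"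
    using mult[OF ideals(2) gen(2), of 0 4] by simp
  with ideals(2) have Sy: "Smarandache_ideal y ?R"
    by (rule Smarandache_ideal_order_3I[where a = "(0, 1, 0)"])
       (use gen(2) in \<open>simp_all add: Z3_Z12_Z7_simps\<close>)
  have Sz: "Smarandache_ideal z ?R"
    using Sx ideals(3) xz by (rule Smarandache_ideal_mono)
  have in_L: "x \<in> carrier ?L" "y \<in> carrier ?L" "z \<in> carrier ?L"
    using Sx Sy Sz by (auto simp: S_ideal_poset_def S_ideal_def)

  have "\<not> is_field_in F ?R" if F: "F \<subseteq> y \<inter> z" for F
  proof
    assume "is_field_in F ?R"
    then obtain e where e: "e \<in> F" "e \<otimes>\<^bsub>?R\<^esub> e = e" "e \<noteq> \<zero>\<^bsub>?R\<^esub>"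
      "(e \<oplus>\<^bsub>?R\<^esub> e) \<otimes>\<^bsub>?R\<^esub> (e \<oplus>\<^bsub>?R\<^esub> e) = \<zero>\<^bsub>?R\<^esub> \<Longrightarrow> e \<oplus>\<^bsub>?R\<^esub> e = \<zero>\<^bsub>?R\<^esub>"
      by (rule is_field_in_obtain_idempotent) blast
    have "e \<in> y" "e \<in> z"
      using e(1) F by auto
    \<comment> \<open>Membership in \<open>y\<close> makes the first coordinate 0, membership in
      \<open>z\<close> makes the second a multiple of 3.\<close>
    then obtain s where s: "e = (0, s * 3 mod 12, 0)"
      by (auto simp: y_def z_def PIdl)
    have "s mod 4 = 0 \<or> s mod 4 = 1 \<or> s mod 4 = 2 \<or> s mod 4 = 3"
      by presburger
    moreover have "s * 3 mod 12 = s mod 4 * 3"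
      by (simp add: mult_mod_left)
    ultimately have "e \<in> {(0, 0, 0), (0, 3, 0), (0, 6, 0), (0, 9, 0)}"
      using s by auto
    \<comment> \<open>3 and 6 are not idempotent mod 12, while 9 is, but 9 + 9 = 6 is nonzero with
      square 0.\<close>
    then show False
      using e(2-4) by (auto simp: Z3_Z12_Z7_simps)
  qed
  then have "\<not> Smarandache_ideal C ?R" if "C \<subseteq> y \<inter> z" for C
    using that unfolding Smarandache_ideal_def by blast
  moreover have "y \<sqinter>\<^bsub>?L\<^esub> z \<subseteq> y \<inter> z" "S_ideal (y \<sqinter>\<^bsub>?L\<^esub> z) ?R"
    using L.meet_left[OF in_L(2,3)] L.meet_right[OF in_L(2,3)] L.meet_closed[OF in_L(2,3)]
    by (simp_all add: S_ideal_poset_def)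
  \<comment> \<open>Containing no field, the meet can be an S-ideal only by convention; ruling out
    the whole ring leaves the zero ideal.\<close>
  moreover have "y \<sqinter>\<^bsub>?L\<^esub> z \<noteq> carrier ?R"
  proof -
    have "(1, 0, 0) \<notin> y" "(1, 0, 0) \<in> carrier ?R" by (auto simp: y_def PIdl)
    then show ?thesis using calculation(2) by blast
  qed
  ultimately have meet: "y \<sqinter>\<^bsub>?L\<^esub> z = {\<zero>\<^bsub>?R\<^esub>}"
    by (simp add: S_ideal_def)
  \<comment> \<open>Two inclusions suffice: the left side of the modular law lies in
    \<open>x\<close>, the right side contains \<open>z\<close>.\<close>
  have "x \<squnion>\<^bsub>?L\<^esub> {\<zero>\<^bsub>?R\<^esub>} \<subseteq> x"
  proof -
    have "{\<zero>\<^bsub>?R\<^esub>} \<in> carrier ?L" by (simp add: S_ideal_poset_def S_ideal_def)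
    moreover have "{\<zero>\<^bsub>?R\<^esub>} \<subseteq> x"
      using ideals(1) by (auto dest: additive_subgroup.zero_closed ideal.axioms(1))
    ultimately show ?thesis
      using L.join_le[where x = x and y = "{\<zero>\<^bsub>?R\<^esub>}" and z = x] in_L(1) by (simp add: S_ideal_poset_def)
  qed
  moreover have "z \<subseteq> (x \<squnion>\<^bsub>?L\<^esub> y) \<sqinter>\<^bsub>?L\<^esub> z"
  proof -
    let ?j = "x \<squnion>\<^bsub>?L\<^esub> y"
    have j: "?j \<in> carrier ?L" "x \<subseteq> ?j" "y \<subseteq> ?j"
      using L.join_closed[OF in_L(1,2)] L.join_left[OF in_L(1,2)] L.join_right[OF in_L(1,2)]
      by (simp_all add: S_ideal_poset_def)
    then have idj: "ideal ?j ?R"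
      using S_ideal_imp_ideal[OF ring_axioms] by (simp add: S_ideal_poset_def)
    \<comment> \<open>9 is 3 - 6 mod 12, so adding it to the generator of \<open>x\<close> gives the
      generator of \<open>z\<close>.\<close>
    have "(0, 9, 0) \<in> y"
      using mult[OF ideals(2) gen(2), of 0 9] by simp
    then have "(1, 6, 0) \<oplus>\<^bsub>?R\<^esub> (0, 9, 0) \<in> ?j"
      using j gen(1) additive_subgroup.a_closed[OF ideal.axioms(1)[OF idj]] by blast
    then have "(1, 3, 0) \<in> ?j"
      by (simp add: Z3_Z12_Z7_simps)
    then have "z \<subseteq> ?j"
      unfolding z_def by (rule cgenideal_minimal[OF idj])
    then show ?thesis
      using L.meet_le[where x = ?j and y = z and z = z] j(1) in_L(3) by (simp add: S_ideal_poset_def)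
  qed
  moreover have "x \<squnion>\<^bsub>?L\<^esub> (y \<sqinter>\<^bsub>?L\<^esub> z) = (x \<squnion>\<^bsub>?L\<^esub> y) \<sqinter>\<^bsub>?L\<^esub> z"
    using L.modular_law in_L xz by (simp add: S_ideal_poset_def)
  ultimately have "z \<subseteq> x"
    by (simp add: meet)
  with gen(3) have "(1, 3, 0) \<in> x" by blast
  \<comment> \<open>Second coordinates in \<open>x\<close> are even, and 3 is odd.\<close>
  then obtain b :: int where "3 = b * 6 mod 12"
    by (auto simp: x_def PIdl)
  then show False by presburger
qed

end
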